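(* Let $n$ be a positive integer, let $X=\mathbb{Z}_n$ be the dihedral quandle, let $K$ be a field of characteristic $0$, and let $\mathcal{A}=K[X]$ be its quandle algebra, with derivation algebra $\mathfrak{D}(\mathcal{A})$. For a linear map $D:\mathcal{A}\to\mathcal{A}$ write $D(e_t)=\sum_{x\in\mathbb{Z}_n}c_t^x e_x$ for $t\in\mathbb{Z}_n$ (all indices are taken modulo $n$). Then: 1) If $n$ is odd, the derivation algebra $\mathfrak{D}(\mathcal{A})$ is trivial, i.e. the only derivation of $\mathcal{A}$ is $0$. 2) If $n=4k$ for some $k$, the matrices $(c_i^j)$ of elements of $\mathfrak{D}(\mathcal{A})$ are characterized by the symmetries $c_{t+2d}^x=c_t^{2t+2d-x}$, $c_t^x=-c_t^{x+2k}$ and $c_t^x=c_{t+2k}^{x+2k}$ for all $x,t,d$; that is, $D\in\mathfrak{D}(\mathcal{A})$ if and only if these hold for all $x,t,d\in\mathbb{Z}_n$. 3) If $n=2k$ for some odd $k$, the matrices $(c_i^j)$ of elements of $\mathfrak{D}(\mathcal{A})$ are characterized by the symmetries $c_{t+2d}^x=c_t^{2t+2d-x}$ and $c_t^x=-c_t^{x+k}$; that is, $D\in\mathfrak{D}(\mathcal{A})$ if and only if these hold for all $x,t,d\in\mathbb{Z}_n$. In particular, the symmetries (in cases 2 and 3, with $k$ as there) imply that $c_t^{k+t}=0$ for all $t$.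
   Context: A quandle is a set $X$ with a binary operation $\triangleright$ such that (I) $x\triangleright x=x$ for all $x$; (II) for all $y,z$ there is a unique $x$ with $x\triangleright y=z$; (III) $(x\triangleright y)\triangleright z=(x\triangleright z)\triangleright(y\triangleright z)$ for all $x,y,z$. The dihedral quandle $\mathbb{Z}_n$ is the set of integers modulo $n$ with $x\triangleright y=2y-x$. For a field $K$, the quandle algebra $K[X]$ is the (generally nonassociative) $K$-algebra with basis $\{e_x\}_{x\in X}$ and bilinear product determined by $e_x\cdot e_y=e_{x\triangleright y}$. A derivation of an algebra $A$ is a linear map $D:A\to A$ with $D(a\cdot b)=D(a)\cdot b+a\cdot D(b)$ for all $a,b\in A$; the derivations of $A$ form a Lie algebra $\mathfrak{D}(A)$, the derivation algebra of $A$.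
   Formalization: The final claim that c_t^{k+t}=0 is stated only for n=4k; for n=2k with k odd it is false for every k and K: D(e_t)=e_t−e_{t+k} satisfies both symmetries but has c_t^{k+t}=−1, so it is omitted there. *)

theory Defs
  imports "HOL-Library.Poly_Mapping" "Berlekamp_Zassenhaus.Finite_Field"
begin

text \<open>The underlying set of a quandle is a whole type here.\<close>

locale quandle =
  fixes op :: "'a \<Rightarrow> 'a \<Rightarrow> 'a"  (infixl \<open>\<triangleright>\<close> 70)
  assumes idem: "x \<triangleright> x = x"
    and right_bij: "\<exists>!x. x \<triangleright> y = z"
    and right_distrib: "(x \<triangleright> y) \<triangleright> z = (x \<triangleright> z) \<triangleright> (y \<triangleright> z)"

text \<open>The integers modulo \<open>n\<close> are the type \<open>'n mod_ring\<close> with \<open>CARD('n) = n\<close>. For \<open>n = 1\<close> this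
  type is only a ring without unit, so \<open>2y\<close> is written \<open>y + y\<close>.\<close>

definition dihedral :: "'n::finite mod_ring \<Rightarrow> 'n mod_ring \<Rightarrow> 'n mod_ring" where
  "dihedral x y = y + y - x"

lemma quandle_dihedral: "quandle dihedral"
proof
  fix y z :: "'n::finite mod_ring"
  show "\<exists>!x. dihedral x y = z"
    by (rule ex1I[of _ "y + y - z"]) (auto simp: dihedral_def algebra_simps)
qed (simp_all add: dihedral_def algebra_simps)

text \<open>\<open>'a \<Rightarrow>\<^sub>0 'k\<close> is the free vector space on \<open>'a\<close>.\<close>

definition qa_scale :: "'k::field \<Rightarrow> ('a \<Rightarrow>\<^sub>0 'k) \<Rightarrow> ('a \<Rightarrow>\<^sub>0 'k)" where
  "qa_scale r a = Poly_Mapping.map ((*) r) a"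

definition qa_basis :: "'a \<Rightarrow> ('a \<Rightarrow>\<^sub>0 'k::field)" where
  "qa_basis x = Poly_Mapping.single x 1"

definition qa_mult ::
  "('a \<Rightarrow> 'a \<Rightarrow> 'a) \<Rightarrow> ('a \<Rightarrow>\<^sub>0 'k::field) \<Rightarrow> ('a \<Rightarrow>\<^sub>0 'k) \<Rightarrow> ('a \<Rightarrow>\<^sub>0 'k)" where
  "qa_mult op a b =
     (\<Sum>x\<in>Poly_Mapping.keys a. \<Sum>y\<in>Poly_Mapping.keys b.
        qa_scale (Poly_Mapping.lookup a x * Poly_Mapping.lookup b y) (qa_basis (op x y)))"

lemma lookup_qa_scale [simp]:
  "Poly_Mapping.lookup (qa_scale r a) x = r * Poly_Mapping.lookup a x"
  unfolding qa_scale_def by transfer (simp add: when_def)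

lemma vector_space_qa_scale: "vector_space (qa_scale :: 'k::field \<Rightarrow> ('a \<Rightarrow>\<^sub>0 'k) \<Rightarrow> _)"
  by unfold_locales (auto intro!: poly_mapping_eqI simp: lookup_add algebra_simps)

lemma qa_mult_basis: "qa_mult op (qa_basis x) (qa_basis y) = (qa_basis (op x y) :: 'a \<Rightarrow>\<^sub>0 'k::field)"
  by (simp add: qa_mult_def qa_basis_def, rule poly_mapping_eqI, simp)

abbreviation qa_linear :: "(('a \<Rightarrow>\<^sub>0 'k::field) \<Rightarrow> ('a \<Rightarrow>\<^sub>0 'k)) \<Rightarrow> bool" where
  "qa_linear \<equiv> Vector_Spaces.linear qa_scale qa_scale"

definition derivation_algebra ::
  "('a \<Rightarrow> 'a \<Rightarrow> 'a) \<Rightarrow> (('a \<Rightarrow>\<^sub>0 'k::field) \<Rightarrow> ('a \<Rightarrow>\<^sub>0 'k)) set" where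
  "derivation_algebra op =
     {D. qa_linear D \<and> (\<forall>a b. D (qa_mult op a b) = qa_mult op (D a) b + qa_mult op a (D b))}"

text \<open>\<open>coef D t x\<close> is the coefficient \<open>c\<^sub>t\<^sup>x\<close> in \<open>D(e\<^sub>t) = \<Sum>\<^sub>x c\<^sub>t\<^sup>x e\<^sub>x\<close>.\<close>

definition coef :: "(('a \<Rightarrow>\<^sub>0 'k::field) \<Rightarrow> ('a \<Rightarrow>\<^sub>0 'k)) \<Rightarrow> 'a \<Rightarrow> 'a \<Rightarrow> 'k" where
  "coef D t x = Poly_Mapping.lookup (D (qa_basis t)) x"

lemma coef_expansion:
  fixes D :: "('a::finite \<Rightarrow>\<^sub>0 'k::field) \<Rightarrow> ('a \<Rightarrow>\<^sub>0 'k)"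
  shows "D (qa_basis t) = (\<Sum>x\<in>UNIV. qa_scale (coef D t x) (qa_basis x))"
  by (rule poly_mapping_eqI)
     (simp add: coef_def lookup_sum qa_basis_def lookup_single when_def if_distrib cong: if_cong)

text \<open>The residue class of an integer; \<open>of_nat\<close> would require \<open>CARD('n) > 1\<close>.\<close>

abbreviation residue :: "nat \<Rightarrow> 'n::finite mod_ring" where
  "residue m \<equiv> of_int_mod_ring (int m)"

text \<open>For \<open>n = 2k\<close> the symmetries do not force \<open>c\<^sub>t\<^sup>k\<^sup>+\<^sup>t\<close> to vanish: the linear map with
  \<open>D(e\<^sub>t) = e\<^sub>t - e\<^sub>t\<^sub>+\<^sub>k\<close> satisfies them. This is why the vanishing is asserted for \<open>n = 4k\<close> only.\<close>

lemma half_turn_coefficients: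
  fixes c :: "'n::finite mod_ring \<Rightarrow> 'n mod_ring \<Rightarrow> 'k::field_char_0"
  assumes n: "CARD('n) = 2 * k"
    and c: "\<And>t x. c t x = (if x = t then 1 else if x = residue k + t then - 1 else 0)"
  shows "c (t + (d + d)) x = c t (t + t + (d + d) - x)"
    and "c t x = - c t (x + residue k)"
    and "c t (residue k + t) \<noteq> 0"
proof -
  define h where "h = (residue k :: 'n mod_ring)"
  have hh: "h + h = 0" unfolding h_def by (transfer fixing: k) (simp add: n mod_simps)
  have "int k mod int (2 * k) \<noteq> 0"
    using n zero_less_card_finite[where 'a='n] by simp
  then have h0: "h \<noteq> 0" unfolding h_def by (transfer fixing: k) (simp add: n)
  have neg: "- h = h" using hh by (simp add: minus_unique)
  have a: "t + t + (d + d) - x = t \<longleftrightarrow> x = t + (d + d)"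
    by (auto simp: algebra_simps)
  have "t + t + (d + d) - x = h + t \<longleftrightarrow> x = - h + (t + (d + d))"
    by (auto simp: algebra_simps)
  then have b: "t + t + (d + d) - x = h + t \<longleftrightarrow> x = h + (t + (d + d))"
    by (simp only: neg)
  show "c (t + (d + d)) x = c t (t + t + (d + d) - x)"
    unfolding c h_def[symmetric] a b by simp
  have "x + h = t \<longleftrightarrow> x = - h + t" by (auto simp: algebra_simps)
  then have e: "x + h = t \<longleftrightarrow> x = h + t" by (simp only: neg)
  show "c t x = - c t (x + residue k)"
    unfolding c h_def[symmetric] e using h0 by (auto simp: add.commute)
  show "c t (residue k + t) \<noteq> 0"
    unfolding c h_def[symmetric] using h0 by simp
qed

end

theory Submission
  imports Defs "HOL-Number_Theory.Residues"
begin

text \<open>Comparing coefficients of \<open>D (e\<^sub>x e\<^sub>y)\<close>, a linear map \<open>D\<close> is a derivation iff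
  \<open>c (2y - x) z = c x (2y - z) + S y (z + x)\<close>, where \<open>S y s\<close> is the sum of \<open>c y w\<close> over \<open>2w = s\<close>. The point is that
  all the sums \<open>S\<close> vanish. For \<open>x = y = t\<close> and \<open>f u = c t (t + u)\<close> the equation reads
  \<open>f u = f (- u) + P u\<close> with \<open>P u\<close> the sum of \<open>f v\<close> over \<open>2v = u\<close>. Hence \<open>P\<close> is odd, and summing
  over the halves of \<open>u\<close> gives \<open>2 P u\<close> as the sum of \<open>P v\<close> over \<open>2v = u\<close>. Since \<open>P\<close> vanishes
  off the doubles, this relation propagates the vanishing to all \<open>u\<close> not divisible by the 2-part
  \<open>2 ^ e\<close> of \<open>n\<close>. On the multiples of \<open>2 ^ e\<close> it becomes \<open>2 P (2 v) = P v\<close>; doubling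
  permutes these multiples, so some power \<open>2 ^ m\<close> with \<open>m > 0\<close> satisfies \<open>2 ^ m P v = P v\<close>, and
  \<open>P = 0\<close> in characteristic 0.\<close>

section \<open>Products, linear maps and derivations in coordinates\<close>

text \<open>Points outside \<open>keys\<close> contribute 0, so both sums may range over the whole
  finite type. The ranges then do not depend on \<open>a\<close> and \<open>b\<close>, and
  summations can be exchanged.\<close>

lemma lookup_qa_mult:
  fixes a b :: "'a::finite \<Rightarrow>\<^sub>0 'k::field"
  shows "Poly_Mapping.lookup (qa_mult op a b) z =
    (\<Sum>x\<in>UNIV. \<Sum>y\<in>UNIV. if op x y = z then Poly_Mapping.lookup a x * Poly_Mapping.lookup b y else 0)"
proof -
  have "Poly_Mapping.lookup (qa_mult op a b) z =
      (\<Sum>x\<in>Poly_Mapping.keys a. \<Sum>y\<in>Poly_Mapping.keys b. if op x y = z then Poly_Mapping.lookup a x * Poly_Mapping.lookup b y else 0)"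
    by (auto simp: qa_mult_def lookup_sum qa_basis_def lookup_single when_def intro!: sum.cong)
  also have "\<dots> = (\<Sum>x\<in>Poly_Mapping.keys a. \<Sum>y\<in>UNIV. if op x y = z then Poly_Mapping.lookup a x * Poly_Mapping.lookup b y else 0)"
    by (intro sum.cong sum.mono_neutral_left refl) (auto simp: in_keys_iff)
  also have "\<dots> = (\<Sum>x\<in>UNIV. \<Sum>y\<in>UNIV. if op x y = z then Poly_Mapping.lookup a x * Poly_Mapping.lookup b y else 0)"
    by (intro sum.mono_neutral_left) (auto simp: in_keys_iff intro!: sum.neutral)
  finally show ?thesis .
qed

lemma lookup_linear:
  fixes D :: "('a::finite \<Rightarrow>\<^sub>0 'k::field) \<Rightarrow> ('a \<Rightarrow>\<^sub>0 'k)"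
  assumes "qa_linear D"
  shows "Poly_Mapping.lookup (D a) z = (\<Sum>t\<in>UNIV. Poly_Mapping.lookup a t * coef D t z)"
proof -
  interpret D: Vector_Spaces.linear qa_scale qa_scale D by fact
  have "a = (\<Sum>t\<in>UNIV. qa_scale (Poly_Mapping.lookup a t) (qa_basis t))"
    by (rule poly_mapping_eqI)
       (simp add: lookup_sum qa_basis_def lookup_single when_def if_distrib cong: if_cong)
  then have "D a = (\<Sum>t\<in>UNIV. qa_scale (Poly_Mapping.lookup a t) (D (qa_basis t)))"
    by (metis (no_types, lifting) D.sum D.scale sum.cong)
  then show ?thesis
    by (simp add: lookup_sum coef_def)
qed

lemma lookup_qa_mult_basis_right:
  fixes a :: "'a::finite \<Rightarrow>\<^sub>0 'k::field"
  shows "Poly_Mapping.lookup (qa_mult op a (qa_basis y)) z = (\<Sum>w | op w y = z. Poly_Mapping.lookup a w)"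
proof -
  have "Poly_Mapping.lookup (qa_mult op a (qa_basis y)) z = (\<Sum>x\<in>UNIV. if op x y = z then Poly_Mapping.lookup a x else 0)"
    unfolding lookup_qa_mult
  proof (intro sum.cong refl)
    fix x
    have "(\<Sum>y'\<in>UNIV. if op x y' = z then Poly_Mapping.lookup a x * Poly_Mapping.lookup (qa_basis y :: 'a \<Rightarrow>\<^sub>0 'k) y' else 0) =
       (\<Sum>y'\<in>UNIV. if y' = y then if op x y' = z then Poly_Mapping.lookup a x else 0 else 0)"
      by (intro sum.cong refl) (auto simp: qa_basis_def lookup_single when_def)
    then show "(\<Sum>y'\<in>UNIV. if op x y' = z then Poly_Mapping.lookup a x * Poly_Mapping.lookup (qa_basis y :: 'a \<Rightarrow>\<^sub>0 'k) y' else 0) =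
       (if op x y = z then Poly_Mapping.lookup a x else 0)"
      by simp
  qed
  then show ?thesis by (simp add: sum.If_cases)
qed

lemma lookup_qa_mult_basis_left:
  fixes b :: "'a::finite \<Rightarrow>\<^sub>0 'k::field"
  shows "Poly_Mapping.lookup (qa_mult op (qa_basis x) b) z = (\<Sum>w | op x w = z. Poly_Mapping.lookup b w)"
proof -
  have "Poly_Mapping.lookup (qa_mult op (qa_basis x) b) z =
     (\<Sum>x'\<in>UNIV. if x' = x then \<Sum>y\<in>UNIV. if op x y = z then Poly_Mapping.lookup b y else 0 else 0)"
    unfolding lookup_qa_mult
    by (intro sum.cong refl) (auto simp: qa_basis_def lookup_single when_def intro!: sum.cong sum.neutral)
  then show ?thesis by (simp add: sum.If_cases)
qed

text \<open>Both sides of the Leibniz rule are bilinear in \<open>a\<close> and \<open>b\<close>, so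
  it suffices to test it on pairs of basis vectors and compare coefficients.\<close>

lemma derivation_iff_coef:
  fixes D :: "('a::finite \<Rightarrow>\<^sub>0 'k::field) \<Rightarrow> ('a \<Rightarrow>\<^sub>0 'k)"
  assumes D: "qa_linear D"
  shows "D \<in> derivation_algebra op \<longleftrightarrow>
    (\<forall>x y z. coef D (op x y) z =
      (\<Sum>w | op w y = z. coef D x w) + (\<Sum>w | op x w = z. coef D y w))"
    (is "_ \<longleftrightarrow> ?R")
proof
  assume "D \<in> derivation_algebra op"
  then have "D (qa_mult op (qa_basis x) (qa_basis y)) =
      qa_mult op (D (qa_basis x)) (qa_basis y) + qa_mult op (qa_basis x) (D (qa_basis y))" for x y
    by (simp add: derivation_algebra_def)
  then have "D (qa_basis (op x y)) =
      qa_mult op (D (qa_basis x)) (qa_basis y) + qa_mult op (qa_basis x) (D (qa_basis y))" for x y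
    by (simp add: qa_mult_basis)
  then show ?R
    by (simp add: coef_def lookup_add lookup_qa_mult_basis_left lookup_qa_mult_basis_right)
next
  assume R: ?R
  \<comment> \<open>The structure constants of the algebra: weighted by \<open>?d\<close>, fibre
    sums become sums over the whole type, which can be reordered freely.\<close>
  let ?d = "\<lambda>x y z. if op x y = z then 1 else 0 :: 'k"
  have R': "coef D (op x y) z =
      (\<Sum>w\<in>UNIV. coef D x w * ?d w y z) + (\<Sum>w\<in>UNIV. coef D y w * ?d x w z)" for x y z
    using R by (simp add: if_distrib[of "(*) _"] sum.If_cases cong: if_cong)
  have m: "Poly_Mapping.lookup (qa_mult op a b) z = (\<Sum>x\<in>UNIV. \<Sum>y\<in>UNIV. Poly_Mapping.lookup a x * Poly_Mapping.lookup b y * ?d x y z)"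
    for a b :: "'a \<Rightarrow>\<^sub>0 'k" and z
    unfolding lookup_qa_mult by (intro sum.cong refl) auto
  have "D (qa_mult op a b) = qa_mult op (D a) b + qa_mult op a (D b)" for a b
  proof (rule poly_mapping_eqI)
    fix z
    have "Poly_Mapping.lookup (D (qa_mult op a b)) z =
        (\<Sum>t\<in>UNIV. \<Sum>x\<in>UNIV. \<Sum>y\<in>UNIV. Poly_Mapping.lookup a x * Poly_Mapping.lookup b y * ?d x y t * coef D t z)"
      by (simp add: lookup_linear[OF D] m sum_distrib_right)
    also have "\<dots> = (\<Sum>x\<in>UNIV. \<Sum>t\<in>UNIV. \<Sum>y\<in>UNIV. Poly_Mapping.lookup a x * Poly_Mapping.lookup b y * ?d x y t * coef D t z)"
      by (rule sum.swap)
    also have "\<dots> = (\<Sum>x\<in>UNIV. \<Sum>y\<in>UNIV. \<Sum>t\<in>UNIV. Poly_Mapping.lookup a x * Poly_Mapping.lookup b y * ?d x y t * coef D t z)"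
      by (rule sum.cong[OF refl]) (rule sum.swap)
    also have "\<dots> = (\<Sum>x\<in>UNIV. \<Sum>y\<in>UNIV. Poly_Mapping.lookup a x * Poly_Mapping.lookup b y * coef D (op x y) z)"
    proof (intro sum.cong refl)
      fix x y
      have "(\<Sum>t\<in>UNIV. Poly_Mapping.lookup a x * Poly_Mapping.lookup b y * ?d x y t * coef D t z) =
          (\<Sum>t\<in>UNIV. if op x y = t then Poly_Mapping.lookup a x * Poly_Mapping.lookup b y * coef D t z else 0)"
        by (intro sum.cong refl) auto
      then show "(\<Sum>t\<in>UNIV. Poly_Mapping.lookup a x * Poly_Mapping.lookup b y * ?d x y t * coef D t z) =
          Poly_Mapping.lookup a x * Poly_Mapping.lookup b y * coef D (op x y) z" by simp
    qed
    finally have L: "Poly_Mapping.lookup (D (qa_mult op a b)) z =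
        (\<Sum>x\<in>UNIV. \<Sum>y\<in>UNIV. Poly_Mapping.lookup a x * Poly_Mapping.lookup b y * coef D (op x y) z)" .
    have "Poly_Mapping.lookup (qa_mult op (D a) b) z =
        (\<Sum>w\<in>UNIV. \<Sum>y\<in>UNIV. \<Sum>x\<in>UNIV. Poly_Mapping.lookup a x * Poly_Mapping.lookup b y * (coef D x w * ?d w y z))"
      unfolding m lookup_linear[OF D] sum_distrib_right sum_distrib_left
      by (intro sum.cong refl) (simp only: ac_simps)
    also have "\<dots> = (\<Sum>w\<in>UNIV. \<Sum>x\<in>UNIV. \<Sum>y\<in>UNIV. Poly_Mapping.lookup a x * Poly_Mapping.lookup b y * (coef D x w * ?d w y z))"
      by (rule sum.cong[OF refl]) (rule sum.swap)
    also have "\<dots> = (\<Sum>x\<in>UNIV. \<Sum>w\<in>UNIV. \<Sum>y\<in>UNIV. Poly_Mapping.lookup a x * Poly_Mapping.lookup b y * (coef D x w * ?d w y z))"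
      by (rule sum.swap)
    also have "\<dots> = (\<Sum>x\<in>UNIV. \<Sum>y\<in>UNIV. \<Sum>w\<in>UNIV. Poly_Mapping.lookup a x * Poly_Mapping.lookup b y * (coef D x w * ?d w y z))"
      by (rule sum.cong[OF refl]) (rule sum.swap)
    finally have R1: "Poly_Mapping.lookup (qa_mult op (D a) b) z =
      (\<Sum>x\<in>UNIV. \<Sum>y\<in>UNIV. \<Sum>w\<in>UNIV. Poly_Mapping.lookup a x * Poly_Mapping.lookup b y * (coef D x w * ?d w y z))" .
    have "Poly_Mapping.lookup (qa_mult op a (D b)) z =
        (\<Sum>x\<in>UNIV. \<Sum>w\<in>UNIV. \<Sum>y\<in>UNIV. Poly_Mapping.lookup a x * Poly_Mapping.lookup b y * (coef D y w * ?d x w z))"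
      unfolding m lookup_linear[OF D] sum_distrib_right sum_distrib_left
      by (intro sum.cong refl) (simp only: ac_simps)
    also have "\<dots> = (\<Sum>x\<in>UNIV. \<Sum>y\<in>UNIV. \<Sum>w\<in>UNIV. Poly_Mapping.lookup a x * Poly_Mapping.lookup b y * (coef D y w * ?d x w z))"
      by (rule sum.cong[OF refl]) (rule sum.swap)
    finally have R2: "Poly_Mapping.lookup (qa_mult op a (D b)) z =
      (\<Sum>x\<in>UNIV. \<Sum>y\<in>UNIV. \<Sum>w\<in>UNIV. Poly_Mapping.lookup a x * Poly_Mapping.lookup b y * (coef D y w * ?d x w z))" .
    show "Poly_Mapping.lookup (D (qa_mult op a b)) z = Poly_Mapping.lookup (qa_mult op (D a) b + qa_mult op a (D b)) z"
      unfolding lookup_add L R1 R2 R' by (simp only: sum_distrib_left[symmetric] sum.distrib distrib_left)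
  qed
  with D show "D \<in> derivation_algebra op" by (simp add: derivation_algebra_def)
qed

section \<open>Vanishing of periodic functions on the integers\<close>

text \<open>The case \<open>e = 0\<close> settles odd periods; a positive \<open>e\<close> gives the
  last stage for even periods.\<close>

lemma periodic_halving_zero:
  fixes p :: "int \<Rightarrow> 'k::field_char_0"
  assumes q: "odd q"
    and per: "\<And>i j. [i = j] (mod 2 ^ e * int q) \<Longrightarrow> p i = p j"
    and half: "\<And>i. 2 ^ e dvd i \<Longrightarrow> 2 * p (2 * i) = p i"
    and b: "2 ^ e dvd b"
  shows "p b = 0"
proof -
  \<comment> \<open>By Euler's theorem, doubling \<open>m\<close> times is the identity modulo the
    odd number \<open>q\<close>.\<close>
  define m where "m = totient q"
  have q0: "q > 0" using q by (rule odd_pos)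
  have iter: "2 ^ j * p (2 ^ j * b) = p b" for j
  proof (induction j)
    case (Suc j)
    have "2 * p (2 * (2 ^ j * b)) = p (2 ^ j * b)" using b by (intro half) simp
    moreover have "2 ^ Suc j * p (2 ^ Suc j * b) = 2 ^ j * (2 * p (2 * (2 ^ j * b)))"
      by (simp add: mult_ac)
    ultimately show ?case using Suc by simp
  qed simp
  have "[2 ^ m = 1] (mod q)" unfolding m_def using q by (intro euler_theorem) simp
  then have "[2 ^ m = 1] (mod int q)"
    using cong_int_iff[of "2 ^ m" 1 q] by simp
  moreover obtain a where a: "b = 2 ^ e * a" using b by blast
  ultimately have "[2 ^ e * (2 ^ m * a) = 2 ^ e * (1 * a)] (mod 2 ^ e * int q)"
    by (metis cong_cmult_leftI cong_scalar_right)
  then have "p (2 ^ m * b) = p b"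
    by (intro per) (simp add: a mult.left_commute)
  with iter[of m] have "(2 ^ m - 1) * p b = 0" by (simp add: algebra_simps)
  moreover have "m > 0" unfolding m_def using q0 by simp
  then have "(2::nat) ^ m \<noteq> 1" by simp
  \<comment> \<open>Characteristic 0 enters here: it keeps \<open>2 ^ m - 1\<close> nonzero in the
    field.\<close>
  then have "of_nat (2 ^ m) \<noteq> (of_nat 1 :: 'k)" by (simp only: of_nat_eq_iff not_False_eq_True)
  then have "(2 ^ m - 1 :: 'k) \<noteq> 0" by simp
  ultimately show ?thesis by simp
qed

text \<open>Modulo \<open>2 * h\<close> the halves of \<open>2 * i\<close> are \<open>i\<close> and
  \<open>i + h\<close>; this is the origin of \<open>avg\<close>.\<close>

lemma periodic_averaging_zero:
  fixes p :: "int \<Rightarrow> 'k::field_char_0"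
  assumes h: "h > 0"
    and per: "\<And>i j. [i = j] (mod 2 * int h) \<Longrightarrow> p i = p j"
    and avg: "\<And>i. 2 * p (2 * i) = p i + p (i + int h)"
    and odd: "\<And>i. odd i \<Longrightarrow> p i = 0"
  shows "p b = 0"
proof -
  obtain q where "h = 2 ^ multiplicity 2 h * q" "odd q"
  proof (rule multiplicity_decompose'[of h 2])
    show "h \<noteq> 0" "\<not> is_unit (2::nat)" using h by simp_all
  qed
  then obtain e where hq: "h = 2 ^ e * q" "odd q" by metis
  text \<open>The induction works up to \<open>j = e + 1\<close> because its step to \<open>j + 1\<close> only needs that translation by
    \<open>h\<close> preserves the multiples of \<open>2 ^ j\<close>.\<close>
  have off: "\<not> 2 ^ j dvd i \<Longrightarrow> p i = 0" if "j \<le> Suc e" for j i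
    using that
  proof (induction j arbitrary: i)
    case (Suc j)
    show ?case
    proof (cases "even i")
      case True
      then obtain v where v: "i = 2 * v" by blast
      have "(2::int) ^ j dvd int h"
        using Suc.prems(2) by (simp add: hq dvd_mult2 le_imp_power_dvd)
      moreover have "\<not> 2 ^ j dvd v" using Suc.prems(1) v by simp
      ultimately have "\<not> 2 ^ j dvd v" "\<not> 2 ^ j dvd v + int h"
        by (simp_all add: dvd_add_left_iff)
      with Suc.IH Suc.prems(2) have "2 * p (2 * v) = 0" by (simp add: avg)
      then show ?thesis by (simp add: v)
    qed (rule odd)
  qed simp
  \<comment> \<open>The power of 2 in \<open>h\<close> is exactly \<open>2 ^ e\<close>, so
    \<open>i + h\<close> leaves the multiples of \<open>2 ^ Suc e\<close> and its term in
    \<open>avg\<close> is already known to vanish.\<close>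
  have half: "2 * p (2 * i) = p i" if "2 ^ Suc e dvd i" for i
  proof -
    have "\<not> (2::int) ^ Suc e dvd int h"
      using hq by simp
    then have "\<not> 2 ^ Suc e dvd i + int h"
      using that by (simp add: dvd_add_right_iff del: power_Suc)
    then show ?thesis using off[of "Suc e" "i + int h"] by (simp add: avg)
  qed
  have "p b = 0" if "2 ^ Suc e dvd b"
  proof (rule periodic_halving_zero[OF hq(2)])
    show "p i = p j" if "[i = j] (mod 2 ^ Suc e * int q)" for i j
      using that by (intro per) (simp add: hq mult.assoc)
  qed (use half that in blast)+
  then show ?thesis using off by blast
qed

section \<open>Residue classes and the fibres of doubling\<close>

lemma of_int_mod_ring_eq_iff:
  "(of_int_mod_ring i :: 'n::finite mod_ring) = of_int_mod_ring j \<longleftrightarrow> [i = j] (mod int CARD('n))"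
  unfolding cong_def by transfer simp

lemma of_int_mod_ring_plus:
  "of_int_mod_ring i + of_int_mod_ring j = (of_int_mod_ring (i + j) :: 'n::finite mod_ring)"
  by transfer (simp add: mod_simps)

lemma residue_add_self:
  assumes "CARD('n::finite) = 2 * k"
  shows "residue k + residue k = (0 :: 'n mod_ring)"
  by (transfer fixing: k) (simp add: assms mod_simps)

lemma surj_of_int_mod_ring: "\<exists>i. v = (of_int_mod_ring i :: 'n::finite mod_ring)"
  by (metis of_int_mod_ring_to_int_mod_ring)

text \<open>2 is invertible modulo an odd number.\<close>

lemma double_eq_odd:
  fixes v :: "'n::finite mod_ring"
  assumes "odd (CARD('n))"
  shows "{w. w + w = v + v} = {v}"
proof -
  have "w = v" if "w + w = v + v" for w
  proof -
    obtain i j where ij: "w = of_int_mod_ring i" "v = of_int_mod_ring j"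
      using surj_of_int_mod_ring by metis
    have "[2 * i = 2 * j] (mod int CARD('n))"
      using that by (simp add: ij of_int_mod_ring_plus of_int_mod_ring_eq_iff)
    moreover have "coprime 2 (int CARD('n))" using assms by simp
    ultimately show ?thesis by (simp add: ij of_int_mod_ring_eq_iff cong_mult_lcancel)
  qed
  then show ?thesis by auto
qed

text \<open>Halves of one element differ by a solution of \<open>x + x = 0\<close>, and modulo
  \<open>2 * k\<close> these are 0 and \<open>k\<close>. The second claim ensures that a sum over
  such a fibre has two separate terms.\<close>

lemma double_eq_even:
  fixes v :: "'n::finite mod_ring"
  assumes n: "CARD('n) = 2 * k"
  shows "{w. w + w = v + v} = {v, v + residue k}" and "v + residue k \<noteq> v"
proof -
  have k: "k > 0" using n zero_less_card_finite[where 'a='n] by simp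
  have "w = v \<or> w = v + residue k" if "w + w = v + v" for w
  proof -
    obtain i j where ij: "w = of_int_mod_ring i" "v = of_int_mod_ring j"
      using surj_of_int_mod_ring by metis
    have "[2 * i = 2 * j] (mod 2 * int k)"
      using that by (simp add: ij of_int_mod_ring_plus of_int_mod_ring_eq_iff n)
    then have "2 * int k dvd 2 * (i - j)" by (simp add: cong_iff_dvd_diff right_diff_distrib)
    then have "int k dvd i - j" by (metis dvd_mult_cancel_left zero_neq_numeral)
    then obtain c where c: "i - j = int k * c" by auto
    show ?thesis
    \<comment> \<open>The parity of \<open>c\<close> decides which of the two halves
      \<open>w\<close> is.\<close>
    proof (cases "even c")
      case True
      then have "[i = j] (mod 2 * int k)" using c by (auto simp: cong_iff_dvd_diff)
      then show ?thesis by (simp add: ij of_int_mod_ring_eq_iff n)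
    next
      case False
      then obtain d where "c = 2 * d + 1" by (elim oddE)
      then have "i - (j + int k) = 2 * int k * d" using c by (simp add: algebra_simps)
      then have "[i = j + int k] (mod 2 * int k)" by (simp add: cong_iff_dvd_diff)
      then show ?thesis by (simp add: ij of_int_mod_ring_plus of_int_mod_ring_eq_iff n)
    qed
  qed
  moreover have "(v + residue k) + (v + residue k) = v + v"
    using residue_add_self[OF n] by (simp add: algebra_simps)
  ultimately show "{w. w + w = v + v} = {v, v + residue k}" by auto
  obtain j where j: "v = of_int_mod_ring j" using surj_of_int_mod_ring by metis
  have "\<not> 2 * int k dvd int k" using k by (auto dest: zdvd_imp_le)
  then show "v + residue k \<noteq> v"
    by (simp add: j of_int_mod_ring_plus of_int_mod_ring_eq_iff n cong_iff_dvd_diff)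
qed

section \<open>Vanishing of the fibre sums\<close>

text \<open>\<open>P\<close> is lifted to a periodic function \<open>p\<close> on the integers,
  where divisibility by arbitrary powers of 2 makes sense whatever the modulus.\<close>

lemma fibre_averaging_zero:
  fixes P :: "'n::finite mod_ring \<Rightarrow> 'k::field_char_0"
  assumes avg: "\<And>v. 2 * P (v + v) = (\<Sum>w | w + w = v + v. P w)"
    and nondouble: "\<And>u. (\<And>v. v + v \<noteq> u) \<Longrightarrow> P u = 0"
  shows "P u = 0"
proof -
  define p where "p i = P (of_int_mod_ring i)" for i
  have per: "p i = p j" if "[i = j] (mod int CARD('n))" for i j
    using that unfolding p_def by (metis of_int_mod_ring_eq_iff)
  have avg': "2 * p (2 * i) =
      (\<Sum>w | w + w = (of_int_mod_ring i + of_int_mod_ring i :: 'n mod_ring). P w)" for i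
    unfolding p_def avg[symmetric] by (simp add: of_int_mod_ring_plus)
  have "p i = 0" for i
  proof (cases "even (CARD('n))")
    case False
    have "2 * p (2 * i) = p i" for i
      unfolding avg' double_eq_odd[OF False] by (simp add: p_def)
    then show ?thesis
      using periodic_halving_zero[OF False, of 0 p i] per by simp
  next
    case True
    then obtain h where n: "CARD('n) = 2 * h" by blast
    show ?thesis
    proof (rule periodic_averaging_zero)
      show "h > 0" using n zero_less_card_finite[where 'a='n] by simp
      show "p i = p j" if "[i = j] (mod 2 * int h)" for i j
        using that by (intro per) (simp add: n)
      show "2 * p (2 * i) = p i + p (i + int h)" for i
        unfolding avg' double_eq_even(1)[OF n]
        using double_eq_even(2)[OF n, of "of_int_mod_ring i"]
        by (simp add: p_def of_int_mod_ring_plus)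
      \<comment> \<open>As the modulus is even, an odd integer is not congruent to any
        double.\<close>
      show "p i = 0" if "odd i" for i
        unfolding p_def
      proof (rule nondouble)
        fix v :: "'n mod_ring"
        obtain j where j: "v = of_int_mod_ring j" using surj_of_int_mod_ring by metis
        have "\<not> 2 * int h dvd 2 * j - i"
          using that by (metis dvd_mult_left even_diff even_mult_iff dvd_trans dvd_triv_left even_add)
        then show "v + v \<noteq> of_int_mod_ring i"
          by (simp add: j of_int_mod_ring_plus of_int_mod_ring_eq_iff n cong_iff_dvd_diff)
      qed
    qed
  qed
  then show ?thesis unfolding p_def using surj_of_int_mod_ring by metis
qed

lemma fibre_sum_zero:
  fixes f :: "'n::finite mod_ring \<Rightarrow> 'k::field_char_0"
  assumes f: "\<And>u. f u = f (- u) + (\<Sum>v | v + v = u. f v)"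
  shows "(\<Sum>v | v + v = u. f v) = 0"
proof -
  define P where "P u = (\<Sum>v | v + v = u. f v)" for u
  have neg_double: "- v - v = u \<longleftrightarrow> v + v = - u" for u v :: "'n mod_ring"
    by (metis diff_conv_add_uminus minus_add_distrib minus_minus)
  have Pneg: "P (- u) = (\<Sum>v | v + v = u. f (- v))" for u
    unfolding P_def
    by (rule sum.reindex_bij_witness[of _ uminus uminus]) (auto simp: neg_double)
  \<comment> \<open>The hypothesis at \<open>u\<close> and at \<open>- u\<close>, one inserted into
    the other, leaves only the two fibre sums.\<close>
  have odd: "P (- u) = - P u" for u
  proof -
    have "f u = f (- u) + P u" and neg: "f (- u) = f u + P (- u)"
      using f[of u] f[of "- u"] by (simp_all only: P_def minus_minus)
    from this(1)[unfolded neg] have "P (- u) + P u = 0"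
      by (simp only: add.assoc add_cancel_right_right)
    then show ?thesis by (simp only: eq_neg_iff_add_eq_0)
  qed
  \<comment> \<open>By oddness \<open>2 * P u\<close> is \<open>P u - P (- u)\<close>, a sum of the
    differences \<open>f v - f (- v)\<close>, each equal to \<open>P v\<close> by
    hypothesis.\<close>
  have avg: "2 * P u = (\<Sum>v | v + v = u. P v)" for u
  proof -
    have "2 * P u = P u - P (- u)" unfolding odd by simp
    also have "\<dots> = (\<Sum>v | v + v = u. f v - f (- v))"
      unfolding Pneg sum_subtractf by (simp only: P_def)
    also have "\<dots> = (\<Sum>v | v + v = u. P v)"
    proof (rule sum.cong[OF refl])
      fix v
      show "f v - f (- v) = P v" by (subst f) (simp only: P_def add_diff_cancel_left')
    qed
    finally show ?thesis .
  qed
  have "P u = 0"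
  proof (rule fibre_averaging_zero)
    show "P u = 0" if "\<And>v. v + v \<noteq> u" for u
      using that by (simp add: P_def)
  qed (rule avg)
  then show ?thesis by (simp add: P_def)
qed

section \<open>Derivations of dihedral quandle algebras\<close>

text \<open>Once the fibre sums vanish, the coefficient form of the Leibniz rule reduces to the
  reflection symmetry. Only fibres over doubles \<open>v + v\<close> are listed, since all others
  are empty.\<close>

lemma derivation_dihedral_iff:
  fixes D :: "('n::finite mod_ring \<Rightarrow>\<^sub>0 'k::field_char_0) \<Rightarrow> ('n mod_ring \<Rightarrow>\<^sub>0 'k)"
  assumes D: "qa_linear D"
  shows "D \<in> derivation_algebra dihedral \<longleftrightarrow>
    (\<forall>x t d. coef D (t + (d + d)) x = coef D t (t + t + (d + d) - x)) \<and>
    (\<forall>t v. (\<Sum>w | w + w = v + v. coef D t w) = 0)"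
    (is "_ \<longleftrightarrow> ?sym \<and> ?fib")
proof -
  have left: "{w. dihedral w y = z} = {y + y - z}" for y z :: "'n mod_ring"
    by (auto simp: dihedral_def algebra_simps)
  have right: "{w. dihedral x w = z} = {w. w + w = z + x}" for x z :: "'n mod_ring"
    by (auto simp: dihedral_def algebra_simps)
  have iff: "D \<in> derivation_algebra dihedral \<longleftrightarrow>
    (\<forall>x y z. coef D (y + y - x) z = coef D x (y + y - z) + (\<Sum>w | w + w = z + x. coef D y w))"
    unfolding derivation_iff_coef[OF D] left right by (simp add: dihedral_def)
  show ?thesis
  proof
    assume "D \<in> derivation_algebra dihedral"
    then have der: "coef D (y + y - x) z =
        coef D x (y + y - z) + (\<Sum>w | w + w = z + x. coef D y w)" for x y z
      using iff by blast
    \<comment> \<open>Recentring at \<open>t\<close> by \<open>w = t + v\<close> brings the fibre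
      sum into the shape of \<open>fibre_sum_zero\<close>.\<close>
    have shift: "(\<Sum>w | w + w = t + t + u. coef D t w) = (\<Sum>v | v + v = u. coef D t (t + v))" for t u
      by (rule sum.reindex_bij_witness[of _ "\<lambda>v. t + v" "\<lambda>w. w - t"]) (auto simp: algebra_simps)
    have "(\<Sum>v | v + v = u. coef D t (t + v)) = 0" for t u
    proof (rule fibre_sum_zero)
      fix u
      show "coef D t (t + u) = coef D t (t + - u) + (\<Sum>v | v + v = u. coef D t (t + v))"
      proof -
        \<comment> \<open>With \<open>x = y = t\<close> the product is \<open>t\<close> itself, so a
          single row of coefficients is related to itself.\<close>
        have "t + t - t = t" "t + t - (t + u) = t + - u" "t + u + t = t + t + u"
          by (simp_all add: algebra_simps)
        then show ?thesis
          using der[of t t "t + u"] by (simp only: shift)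
      qed
    qed
    then have zero: "(\<Sum>w | w + w = s. coef D t w) = 0" for t s
      using shift[of t "s - (t + t)"] by simp
    have "coef D (t + (d + d)) x = coef D t (t + t + (d + d) - x)" for t d x
      \<comment> \<open>The instance \<open>y = t + d\<close>, \<open>x = t\<close>, for which
        \<open>y + y - x\<close> is \<open>t + (d + d)\<close>.\<close>
      using der[of "t + d" t x] by (simp add: zero algebra_simps)
    with zero show "?sym \<and> ?fib" by blast
  next
    assume R: "?sym \<and> ?fib"
    have zero: "(\<Sum>w | w + w = s. coef D t w) = 0" for s t
    proof (cases "\<exists>v. v + v = s")
      case True
      then show ?thesis using R by blast
    qed (auto intro: sum.neutral)
    have "coef D (y + y - x) z = coef D x (y + y - z)" for x y z
    proof -
      \<comment> \<open>Conversely, \<open>d = y - x\<close> recovers the general product.\<close>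
      have "coef D (x + ((y - x) + (y - x))) z = coef D x (x + x + ((y - x) + (y - x)) - z)"
        using R by blast
      then show ?thesis by (simp add: algebra_simps)
    qed
    with zero show "D \<in> derivation_algebra dihedral" by (simp add: iff)
  qed
qed

text \<open>Every fibre of doubling is a single point, so a vanishing fibre sum is a vanishing
  coefficient.\<close>

lemma derivation_dihedral_odd:
  assumes "odd (CARD('n))"
  shows "derivation_algebra (dihedral :: 'n::finite mod_ring \<Rightarrow> _) =
    {\<lambda>a. 0 :: 'n mod_ring \<Rightarrow>\<^sub>0 'k::field_char_0}"
proof -
  interpret vs: vector_space "qa_scale :: 'k \<Rightarrow> ('n mod_ring \<Rightarrow>\<^sub>0 'k) \<Rightarrow> _"
    by (rule vector_space_qa_scale)
  have lin: "qa_linear (\<lambda>a :: 'n mod_ring \<Rightarrow>\<^sub>0 'k. 0 :: 'n mod_ring \<Rightarrow>\<^sub>0 'k)"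
    by unfold_locales auto
  then have "(\<lambda>a. 0 :: 'n mod_ring \<Rightarrow>\<^sub>0 'k) \<in> derivation_algebra (dihedral :: 'n mod_ring \<Rightarrow> _)"
    by (simp add: derivation_algebra_def qa_mult_def)
  moreover have "D = (\<lambda>a. 0)" if D: "D \<in> derivation_algebra dihedral"
    for D :: "('n mod_ring \<Rightarrow>\<^sub>0 'k) \<Rightarrow> ('n mod_ring \<Rightarrow>\<^sub>0 'k)"
  proof -
    have lin: "qa_linear D" using D by (simp add: derivation_algebra_def)
    have "coef D t v = 0" for t v
      using D unfolding derivation_dihedral_iff[OF lin] double_eq_odd[OF assms] by simp
    then show ?thesis
      by (intro ext poly_mapping_eqI) (simp add: lookup_linear[OF lin])
  qed
  ultimately show ?thesis by blast
qed

text \<open>A nonempty fibre is a pair \<open>v\<close>, \<open>v + residue k\<close>, so a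
  vanishing fibre sum means a change of sign under the shift by \<open>residue k\<close>. This
  serves both even cases of the theorem.\<close>

lemma derivation_dihedral_even_iff:
  fixes D :: "('n::finite mod_ring \<Rightarrow>\<^sub>0 'k::field_char_0) \<Rightarrow> ('n mod_ring \<Rightarrow>\<^sub>0 'k)"
  assumes "qa_linear D" and n: "CARD('n) = 2 * k"
  shows "D \<in> derivation_algebra dihedral \<longleftrightarrow>
    (\<forall>x t d. coef D (t + (d + d)) x = coef D t (t + t + (d + d) - x)) \<and>
    (\<forall>x t. coef D t x = - coef D t (x + residue k))"
  unfolding derivation_dihedral_iff[OF assms(1)] double_eq_even(1)[OF n]
  using double_eq_even(2)[OF n, THEN not_sym]
  by (auto simp: eq_neg_iff_add_eq_0)

theorem theorem3p9:
  fixes DA :: "(('n::finite mod_ring \<Rightarrow>\<^sub>0 'k::field_char_0) \<Rightarrow> ('n mod_ring \<Rightarrow>\<^sub>0 'k)) set"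
    and n :: nat
  assumes n: "n = CARD('n)"
    and DA: "DA = derivation_algebra dihedral"
  shows "(odd n \<longrightarrow> DA = {\<lambda>a. 0}) \<and>
    (\<forall>k. n = 4 * k \<longrightarrow>
      (\<forall>D. qa_linear D \<longrightarrow>
        (D \<in> DA \<longleftrightarrow>
          (\<forall>x t d. coef D (t + (d + d)) x = coef D t (t + t + (d + d) - x)) \<and>
          (\<forall>x t. coef D t x = - coef D t (x + residue (2 * k))) \<and>
          (\<forall>x t. coef D t x = coef D (t + residue (2 * k)) (x + residue (2 * k)))) \<and>
        ((\<forall>x t d. coef D (t + (d + d)) x = coef D t (t + t + (d + d) - x)) \<and>
          (\<forall>x t. coef D t x = - coef D t (x + residue (2 * k))) \<and>
          (\<forall>x t. coef D t x = coef D (t + residue (2 * k)) (x + residue (2 * k))) \<longrightarrow>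
          (\<forall>t. coef D t (residue k + t) = 0)))) \<and>
    (\<forall>k. odd k \<and> n = 2 * k \<longrightarrow>
      (\<forall>D. qa_linear D \<longrightarrow>
        (D \<in> DA \<longleftrightarrow>
          (\<forall>x t d. coef D (t + (d + d)) x = coef D t (t + t + (d + d) - x)) \<and>
          (\<forall>x t. coef D t x = - coef D t (x + residue k)))))"
proof (intro conjI allI impI)
  assume "odd n"
  then show "DA = {\<lambda>a. 0}" unfolding n DA by (rule derivation_dihedral_odd)
next
  fix k and D :: "('n mod_ring \<Rightarrow>\<^sub>0 'k) \<Rightarrow> ('n mod_ring \<Rightarrow>\<^sub>0 'k)"
  assume "n = 4 * k" and D: "qa_linear D"
  then have card: "CARD('n) = 2 * (2 * k)" using n by simp
  have twice: "residue (2 * k) = (residue k + residue k :: 'n mod_ring)"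
    by (simp add: of_int_mod_ring_plus)
  \<comment> \<open>The third symmetry follows from the first: \<open>d = residue k\<close> moves
    \<open>t\<close> by \<open>2 * k\<close>, and \<open>d = 0\<close> is the reflection of
    \<open>x\<close> to \<open>t + t - x\<close>.\<close>
  have "coef D t x = coef D (t + residue (2 * k)) (x + residue (2 * k))"
    if sym: "\<And>x t d. coef D (t + (d + d)) x = coef D t (t + t + (d + d) - x)" for x t
  proof -
    have "coef D (t + (residue k + residue k)) (x + residue (2 * k)) = coef D t (t + t - x)"
      unfolding sym by (simp only: twice) (simp add: algebra_simps)
    also have "\<dots> = coef D t x" using sym[of t 0 x] by simp
    finally show ?thesis by (simp only: twice)
  qed
  then show "D \<in> DA \<longleftrightarrow>
      (\<forall>x t d. coef D (t + (d + d)) x = coef D t (t + t + (d + d) - x)) \<and>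
      (\<forall>x t. coef D t x = - coef D t (x + residue (2 * k))) \<and>
      (\<forall>x t. coef D t x = coef D (t + residue (2 * k)) (x + residue (2 * k)))"
    unfolding DA derivation_dihedral_even_iff[OF D card] by blast
next
  fix k and D :: "('n mod_ring \<Rightarrow>\<^sub>0 'k) \<Rightarrow> ('n mod_ring \<Rightarrow>\<^sub>0 'k)" and t
  assume S: "(\<forall>x t d. coef D (t + (d + d)) x = coef D t (t + t + (d + d) - x)) \<and>
      (\<forall>x t. coef D t x = - coef D t (x + residue (2 * k))) \<and>
      (\<forall>x t. coef D t x = coef D (t + residue (2 * k)) (x + residue (2 * k)))"
  have twice: "residue (2 * k) = (residue k + residue k :: 'n mod_ring)"
    by (simp add: of_int_mod_ring_plus)
  \<comment> \<open>The reflection \<open>d = 0\<close> sends \<open>residue k + t\<close> to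
    \<open>t - residue k\<close>; the shift by \<open>residue (2 * k)\<close> leads back with a
    change of sign.\<close>
  have "coef D (t + (0 + 0)) (residue k + t) = coef D t (t + t + (0 + 0) - (residue k + t))"
    using S by blast
  then have "coef D t (residue k + t) = coef D t (t - residue k)" by (simp add: algebra_simps)
  also have "\<dots> = - coef D t (t - residue k + residue (2 * k))" using S by blast
  also have "\<dots> = - coef D t (residue k + t)" by (simp only: twice) (simp add: algebra_simps)
  finally show "coef D t (residue k + t) = 0" by (simp add: eq_neg_iff_add_eq_0 mult_2[symmetric])
next
  fix k and D :: "('n mod_ring \<Rightarrow>\<^sub>0 'k) \<Rightarrow> ('n mod_ring \<Rightarrow>\<^sub>0 'k)"
  assume "odd k \<and> n = 2 * k" and D: "qa_linear D"
  then show "D \<in> DA \<longleftrightarrow>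
      (\<forall>x t d. coef D (t + (d + d)) x = coef D t (t + t + (d + d) - x)) \<and>
      (\<forall>x t. coef D t x = - coef D t (x + residue k))"
    unfolding DA using n by (intro derivation_dihedral_even_iff) auto
qed

end
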